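(* Let $d\ge1$, $M>0$, and let $\mathbf F:[-M,M]\to\mathbb R^d$ be an analytic function. Then the following four conditions are equivalent: (a) there exist $\alpha>0$ and $C>0$ such that for all $\delta>0$, $$\sup_{\tau^2+|\xi|^2=1}\bigl|\{v\in[-M,M]:\ |\tau+\mathbf F'(v)\cdot\xi|\le\delta\}\bigr|\le C\,\delta^\alpha,$$ where $(\tau,\xi)\in\mathbb R\times\mathbb R^d$ and $|\cdot|$ of a set is its Lebesgue measure; (b) for every $u\in[-M,M]$ there exists an integer $m\ge1$ such that $\operatorname{rank}\{\mathbf F''(u),\dots,\mathbf F^{(m+1)}(u)\}=d$; (c) for every $(\tau,\xi)\in\mathbb R\times\mathbb R^d$ with $\tau^2+|\xi|^2=1$, the set $\{v\in[-M,M]:\ \tau+\mathbf F'(v)\cdot\xi=0\}$ has null Lebesgue measure; (d) for any sub-interval $I$ of $[-M,M]$ with nonempty interior and any $\xi\in\mathbb R^d$, if $\xi\cdot\mathbf F''(u)=0$ for all $u\in I$ then $\xi=0$.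
   Context: Analytic means real-analytic on the closed interval $[-M,M]$ (i.e. the restriction of a real-analytic function defined on a neighborhood). The rank of a finite set of vectors of $\mathbb R^d$ is the dimension of their span. *)

theory Defs
  imports "HOL-Analysis.Analysis"
begin

definition real_analytic_on :: "(real \<Rightarrow> 'a::real_normed_vector) \<Rightarrow> real set \<Rightarrow> bool" where
  "real_analytic_on g U \<longleftrightarrow>
     open U \<and>
     (\<forall>x\<in>U. \<exists>r>0. \<exists>c :: nat \<Rightarrow> 'a. \<forall>y. \<bar>y - x\<bar> < r \<longrightarrow> (\<lambda>n. (y - x) ^ n *\<^sub>R c n) sums g y)"

text \<open>A function defined on \<open>S\<close> only (its values elsewhere are irrelevant) that is the
  restriction of a real-analytic function on a neighbourhood of \<open>S\<close>.\<close>

definition analytic_restriction_on :: "(real \<Rightarrow> 'a::real_normed_vector) \<Rightarrow> real set \<Rightarrow> bool" where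
  "analytic_restriction_on f S \<longleftrightarrow>
     (\<exists>U g. S \<subseteq> U \<and> real_analytic_on g U \<and> (\<forall>x\<in>S. f x = g x))"

text \<open>The derivatives are taken within \<open>S\<close>, hence are one-sided at the endpoints of a compact
  interval. There they agree with the derivatives of any analytic extension.
  Only the values at points of \<open>S\<close> are meaningful.\<close>

primrec deriv_within :: "nat \<Rightarrow> (real \<Rightarrow> 'a::real_normed_vector) \<Rightarrow> real set \<Rightarrow> real \<Rightarrow> 'a" where
  "deriv_within 0 f S = f"
| "deriv_within (Suc k) f S = (\<lambda>x. vector_derivative (deriv_within k f S) (at x within S))"

end

theory Submission imports Defs begin

text \<open>The conditions are linked in the cycle a, c, d, b, a. The first two steps are elementary: let
  \<open>\<delta>\<close> tend to 0, and note that \<open>\<xi> \<bullet> F'' = 0\<close> on an interval makes \<open>\<xi> \<bullet> F'\<close> constant there.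
  If b fails at \<open>u\<close>, some \<open>\<xi> \<noteq> 0\<close> is orthogonal to every derivative of \<open>F''\<close> at \<open>u\<close>, so
  \<open>\<xi> \<bullet> F''\<close> vanishes identically by analyticity, contradicting d. If b holds, then near every
  point of the compact set of all \<open>(u, \<tau>, \<xi>)\<close> some derivative of \<open>\<tau> + F' \<bullet> \<xi>\<close> is bounded away
  from 0, so a van der Corput type sublevel estimate holds there, and finitely many of these
  estimates cover the set.\<close>

section \<open>Sublevel sets of functions with a derivative bounded away from zero\<close>

text \<open>The induction splits \<open>J\<close> into the points where \<open>\<bar>f m\<bar> < L * \<epsilon>\<close>, which lie in an interval of
  length \<open>4 * \<epsilon>\<close> since \<open>\<bar>f (Suc m)\<bar> \<ge> L\<close>, and two intervals where \<open>\<bar>f m\<bar> \<ge> L * \<epsilon>\<close>.\<close>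

lemma sublevel_cover:
  fixes f :: "nat \<Rightarrow> real \<Rightarrow> real"
  assumes "is_interval J"
    and "\<And>k x. x \<in> J \<Longrightarrow> (f k has_real_derivative f (Suc k) x) (at x)"
    and "\<And>x. x \<in> J \<Longrightarrow> L \<le> \<bar>f m x\<bar>"
    and "0 < L" "0 < \<epsilon>"
  shows "\<exists>B\<in>lmeasurable. {x \<in> J. \<bar>f 0 x\<bar> < L * \<epsilon> ^ m} \<subseteq> B \<and> measure lebesgue B \<le> 4 * (2 ^ m - 1) * \<epsilon>"
  using assms
proof (induction m arbitrary: J L)
  case 0
  then have "{x \<in> J. \<bar>f 0 x\<bar> < L * \<epsilon> ^ 0} = {}" by force
  then show ?case by (intro bexI[of _ "{}"]) auto
next
  case (Suc m)
  note deriv = Suc.prems(2) and lower = Suc.prems(3)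
  have step: "\<exists>z\<in>J. a \<le> z \<and> z \<le> b \<and> f m b - f m a = (b - a) * f (Suc m) z"
    if "a \<in> J" "b \<in> J" "a \<le> b" for a b
  proof (cases "a = b")
    case False
    with that have "a < b" by simp
    have sub: "x \<in> J" if "a \<le> x" "x \<le> b" for x
      using \<open>is_interval J\<close> \<open>a \<in> J\<close> \<open>b \<in> J\<close> that unfolding is_interval_1 by blast
    obtain z where "a < z" "z < b" "f m b - f m a = (b - a) * f (Suc m) z"
      using MVT2[OF \<open>a < b\<close>, of "f m" "f (Suc m)"] deriv sub by blast
    then show ?thesis using sub by (intro bexI[of _ z]) auto
  qed (use that in auto)
  \<comment> \<open>\<open>f (Suc m)\<close> is continuous because it has the derivative
    \<open>f (Suc (Suc m))\<close>. As it avoids 0 on the connected set \<open>J\<close>, it keeps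
    one sign there, which makes \<open>f m\<close> monotone.\<close>
  have "connected (f (Suc m) ` J)"
    using \<open>is_interval J\<close> deriv
    by (intro connected_continuous_image continuous_at_imp_continuous_on)
       (auto simp: is_interval_connected_1 intro: DERIV_isCont)
  then have sign: "(\<forall>x\<in>J. f (Suc m) x > 0) \<or> (\<forall>x\<in>J. f (Suc m) x < 0)"
  proof -
    have ne: "0 \<notin> f (Suc m) ` J" using lower \<open>0 < L\<close> by force
    show ?thesis
    proof (rule ccontr)
      assume "\<not> ?thesis"
      then obtain x y where "x \<in> J" "y \<in> J" "f (Suc m) x \<le> 0" "0 \<le> f (Suc m) y"
        by (auto simp: not_less)
      then have "0 \<in> f (Suc m) ` J"
        using \<open>connected (f (Suc m) ` J)\<close> unfolding connected_iff_interval by blast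
      with ne show False by simp
    qed
  qed
  have mono: "(\<forall>a\<in>J. \<forall>b\<in>J. a \<le> b \<longrightarrow> f m a \<le> f m b) \<or> (\<forall>a\<in>J. \<forall>b\<in>J. a \<le> b \<longrightarrow> f m b \<le> f m a)"
    using sign
  proof
    assume pos: "\<forall>x\<in>J. f (Suc m) x > 0"
    have "f m a \<le> f m b" if ab: "a \<in> J" "b \<in> J" "a \<le> b" for a b
    proof -
      obtain z where "z \<in> J" "f m b - f m a = (b - a) * f (Suc m) z" using step[OF ab] by blast
      moreover have "0 \<le> (b - a) * f (Suc m) z" using pos ab \<open>z \<in> J\<close> by (simp add: less_imp_le)
      ultimately show ?thesis by simp
    qed
    then show ?thesis by blast
  next
    assume neg: "\<forall>x\<in>J. f (Suc m) x < 0"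
    have "f m b \<le> f m a" if ab: "a \<in> J" "b \<in> J" "a \<le> b" for a b
    proof -
      obtain z where "z \<in> J" "f m b - f m a = (b - a) * f (Suc m) z" using step[OF ab] by blast
      moreover have "(b - a) * f (Suc m) z \<le> 0" using neg ab \<open>z \<in> J\<close>
        by (simp add: less_imp_le mult_nonneg_nonpos)
      ultimately show ?thesis by simp
    qed
    then show ?thesis by blast
  qed
  define P where "P = {x \<in> J. f m x \<ge> L * \<epsilon>}"
  define N where "N = {x \<in> J. f m x \<le> - (L * \<epsilon>)}"
  define A where "A = {x \<in> J. \<bar>f m x\<bar> < L * \<epsilon>}"
  \<comment> \<open>Monotonicity of \<open>f m\<close> makes both sets intervals, as the induction
    hypothesis requires.\<close>
  have PN: "is_interval P" "is_interval N"
    using \<open>is_interval J\<close> mono unfolding is_interval_1 P_def N_def by (blast intro: order_trans)+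
  have Le: "0 < L * \<epsilon>" using Suc.prems by simp
  \<comment> \<open>The induction hypothesis is used with \<open>L * \<epsilon>\<close> in place of
    \<open>L\<close>, so its threshold \<open>L * \<epsilon> * \<epsilon> ^ m\<close> is the one
    wanted for \<open>Suc m\<close>.\<close>
  have "\<exists>B\<in>lmeasurable. {x \<in> P. \<bar>f 0 x\<bar> < L * \<epsilon> * \<epsilon> ^ m} \<subseteq> B \<and> measure lebesgue B \<le> 4 * (2 ^ m - 1) * \<epsilon>"
    by (rule Suc.IH) (use PN Le deriv Suc.prems(5) in \<open>auto simp: P_def\<close>)
  then obtain BP where BP: "BP \<in> lmeasurable" "{x \<in> P. \<bar>f 0 x\<bar> < L * \<epsilon> * \<epsilon> ^ m} \<subseteq> BP"
    "measure lebesgue BP \<le> 4 * (2 ^ m - 1) * \<epsilon>" by blast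
  have "\<exists>B\<in>lmeasurable. {x \<in> N. \<bar>f 0 x\<bar> < L * \<epsilon> * \<epsilon> ^ m} \<subseteq> B \<and> measure lebesgue B \<le> 4 * (2 ^ m - 1) * \<epsilon>"
    by (rule Suc.IH) (use PN Le deriv Suc.prems(5) in \<open>auto simp: N_def\<close>)
  then obtain BN where BN: "BN \<in> lmeasurable" "{x \<in> N. \<bar>f 0 x\<bar> < L * \<epsilon> * \<epsilon> ^ m} \<subseteq> BN"
    "measure lebesgue BN \<le> 4 * (2 ^ m - 1) * \<epsilon>" by blast
  \<comment> \<open>Two values of \<open>f m\<close> on \<open>A\<close> differ by less than
    \<open>2 * L * \<epsilon>\<close>, while its slope is at least \<open>L\<close> in
    modulus.\<close>
  have diam: "\<bar>x - y\<bar> \<le> 2 * \<epsilon>" if "x \<in> A" "y \<in> A" for x y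
  proof -
    have *: "b - a \<le> 2 * \<epsilon>" if ab: "a \<in> A" "b \<in> A" "a \<le> b" for a b
    proof -
      obtain z where z: "z \<in> J" "f m b - f m a = (b - a) * f (Suc m) z"
        using step[of a b] ab by (auto simp: A_def)
      have "L * (b - a) \<le> \<bar>f (Suc m) z\<bar> * (b - a)"
        using lower[OF z(1)] that by (intro mult_right_mono) auto
      also have "\<dots> = \<bar>f m b - f m a\<bar>" using z that by (simp add: abs_mult mult.commute)
      also have "\<dots> \<le> L * (2 * \<epsilon>)" using that by (auto simp: A_def)
      finally show ?thesis using \<open>0 < L\<close> by simp
    qed
    show ?thesis using *[of x y] *[of y x] that by linarith
  qed
  have "\<exists>p. A \<subseteq> {p - 2 * \<epsilon> .. p + 2 * \<epsilon>}"
  proof (cases "A = {}")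
    case False
    then obtain p where "p \<in> A" by blast
    then show ?thesis using diam by (intro exI[of _ p]) (force simp: abs_le_iff)
  qed simp
  then obtain p where p: "A \<subseteq> {p - 2 * \<epsilon> .. p + 2 * \<epsilon>}" by blast
  let ?I = "{p - 2 * \<epsilon> .. p + 2 * \<epsilon>}"
  have I: "?I \<in> lmeasurable" "measure lebesgue ?I = 4 * \<epsilon>"
    using \<open>0 < \<epsilon>\<close> by (auto simp: measure_completion)
  show ?case
  proof (intro bexI[of _ "BP \<union> BN \<union> ?I"] conjI)
    show "{x \<in> J. \<bar>f 0 x\<bar> < L * \<epsilon> ^ Suc m} \<subseteq> BP \<union> BN \<union> ?I"
    proof
      fix x assume x: "x \<in> {x \<in> J. \<bar>f 0 x\<bar> < L * \<epsilon> ^ Suc m}"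
      then have "x \<in> P \<or> x \<in> N \<or> x \<in> A" by (auto simp: P_def N_def A_def)
      moreover have "\<bar>f 0 x\<bar> < L * \<epsilon> * \<epsilon> ^ m" using x by (simp add: mult.assoc)
      ultimately show "x \<in> BP \<union> BN \<union> ?I" using BP(2) BN(2) p by blast
    qed
    have "measure lebesgue (BP \<union> BN \<union> ?I) \<le> measure lebesgue BP + measure lebesgue BN + measure lebesgue ?I"
      using measure_Un_le[of "BP \<union> BN" lebesgue ?I] measure_Un_le[of BP lebesgue BN] BP(1) BN(1) I(1)
      by (force simp: fmeasurableD)
    \<comment> \<open>Two pieces from the induction and one interval:
      \<open>2 * 4 * (2 ^ m - 1) + 4 = 4 * (2 ^ Suc m - 1)\<close>.\<close>
    also have "\<dots> \<le> 4 * (2 ^ Suc m - 1) * \<epsilon>"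
      using BP(3) BN(3) I(2) by (simp add: algebra_simps)
    finally show "measure lebesgue (BP \<union> BN \<union> ?I) \<le> 4 * (2 ^ Suc m - 1) * \<epsilon>" .
    show "BP \<union> BN \<union> ?I \<in> lmeasurable" using BP(1) BN(1) I(1) by (intro fmeasurable.Un)
  qed
qed

text \<open>A finite subcover is built up from \<open>{}\<close> by unions, and heredity passes from
  its union to \<open>K\<close>. This turns the local sublevel estimates into a global one.\<close>

lemma compact_union_induct:
  assumes "compact K"
    and "\<And>p. p \<in> K \<Longrightarrow> \<exists>T. open T \<and> p \<in> T \<and> P T"
    and "P {}"
    and "\<And>A B. P A \<Longrightarrow> P B \<Longrightarrow> P (A \<union> B)"
    and "\<And>A B. P B \<Longrightarrow> A \<subseteq> B \<Longrightarrow> P A"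
  shows "P K"
proof -
  have "\<forall>p\<in>K. \<exists>T. open T \<and> p \<in> T \<and> P T" using assms(2) by blast
  then obtain T where T: "\<And>p. p \<in> K \<Longrightarrow> open (T p) \<and> p \<in> T p \<and> P (T p)" by metis
  obtain C where C: "C \<subseteq> K" "finite C" "K \<subseteq> (\<Union>p\<in>C. T p)"
    using compactE_image[OF assms(1), of K T] T by blast
  have "P (\<Union>p\<in>C. T p)"
    using C(2,1) by (induction C) (use assms T in auto)
  then show ?thesis using assms(5) C(3) by blast
qed

section \<open>Power series, real-analytic functions and their derivatives\<close>

text \<open>Termwise differentiation, moved from centre 0 to centre \<open>x\<close>. The conclusion
  again gives a convergent series on the same ball, so the result can be iterated.\<close>

lemma power_series_DERIV:
  fixes g :: "real \<Rightarrow> real"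
  assumes g: "\<And>y. \<bar>y - x\<bar> < r \<Longrightarrow> (\<lambda>n. c n * (y - x) ^ n) sums g y"
    and y: "\<bar>y - x\<bar> < r"
  shows "\<exists>D. (g has_real_derivative D) (at y) \<and> (\<lambda>n. diffs c n * (y - x) ^ n) sums D"
proof -
  have sm: "summable (\<lambda>n. c n * z ^ n)" if "norm z < r" for z
    using g[of "x + z"] that by (auto simp: sums_iff)
  have "((\<lambda>z. \<Sum>n. c n * z ^ n) has_real_derivative (\<Sum>n. diffs c n * (y - x) ^ n)) (at (y - x))"
    using termdiffs_strong'[of r c "y - x"] sm y by simp
  then have "((\<lambda>z. \<Sum>n. c n * (z - x) ^ n) has_real_derivative (\<Sum>n. diffs c n * (y - x) ^ n)) (at y)"
    using DERIV_shift[of "\<lambda>z. \<Sum>n. c n * z ^ n" _ y "-x"] by (simp add: add.commute)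
  moreover have "open {z. \<bar>z - x\<bar> < r}" "y \<in> {z. \<bar>z - x\<bar> < r}"
    using y by (auto intro!: open_Collect_less continuous_intros)
  ultimately have "(g has_real_derivative (\<Sum>n. diffs c n * (y - x) ^ n)) (at y)"
    by (rule has_field_derivative_transform_within_open) (use g in \<open>auto simp: sums_iff\<close>)
  moreover have "summable (\<lambda>n. diffs c n * (y - x) ^ n)"
    using termdiff_converges[of "y - x" r c] sm y by simp
  ultimately show ?thesis by (auto simp: summable_sums)
qed

text \<open>This is Taylor's formula for coefficients: the constant term of the
  \<open>k\<close>-fold differentiated series is the \<open>k\<close>-th derivative at the
  centre.\<close>

lemma funpow_diffs_0: "(diffs ^^ k) c 0 = fact k * (c k :: real)"
proof -
  \<comment> \<open>Each \<open>diffs\<close> shifts the index by one, so the induction needs every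
    \<open>n\<close> and not only 0.\<close>
  have "fact n * (diffs ^^ k) c n = fact (n + k) * c (n + k)" for n
  proof (induction k arbitrary: n)
    case (Suc k)
    have "(diffs ^^ Suc k) c n = real (Suc n) * (diffs ^^ k) c (Suc n)"
      by (simp add: diffs_def[of "(diffs ^^ k) c"])
    then have "fact n * (diffs ^^ Suc k) c n = fact (Suc n) * (diffs ^^ k) c (Suc n)"
      by (simp add: algebra_simps del: funpow.simps)
    then show ?case by (simp only: Suc.IH add_Suc add_Suc_right)
  qed simp
  from this[of 0] show ?thesis by simp
qed

lemma real_analytic_on_DERIV:
  fixes g :: "real \<Rightarrow> real"
  assumes "real_analytic_on g U" "x \<in> U"
  shows "(g has_real_derivative deriv g x) (at x)"
proof -
  obtain r c where "r > 0" "\<And>y. \<bar>y - x\<bar> < r \<Longrightarrow> (\<lambda>n. c n * (y - x) ^ n) sums g y"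
    using assms unfolding real_analytic_on_def by (force simp: mult.commute)
  then have "\<exists>D. (g has_real_derivative D) (at x)" using power_series_DERIV[of x r c g x] by auto
  then show ?thesis using DERIV_imp_deriv by blast
qed

text \<open>The differentiated local expansions represent \<open>g'\<close>. Allowing any
  \<open>g'\<close> that is a derivative on \<open>U\<close>, and not just \<open>deriv g\<close>,
  makes the result applicable to the components of a given sequence of derivatives.\<close>

lemma real_analytic_on_derivative:
  fixes g :: "real \<Rightarrow> real"
  assumes "real_analytic_on g U"
    and g': "\<And>x. x \<in> U \<Longrightarrow> (g has_real_derivative g' x) (at x)"
  shows "real_analytic_on g' U"
  unfolding real_analytic_on_def
proof (intro conjI ballI)
  show "open U" using assms by (simp add: real_analytic_on_def)
  fix x assume "x \<in> U"
  then obtain r c where rc: "r > 0" "\<And>y. \<bar>y - x\<bar> < r \<Longrightarrow> (\<lambda>n. c n * (y - x) ^ n) sums g y"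
    using assms(1) unfolding real_analytic_on_def by (force simp: mult.commute)
  obtain s where s: "s > 0" "ball x s \<subseteq> U"
    using \<open>open U\<close> \<open>x \<in> U\<close> by (meson open_contains_ball)
  \<comment> \<open>Only on \<open>U\<close> is \<open>g'\<close> known to be the derivative, hence
    the radius \<open>min r s\<close>.\<close>
  have "(\<lambda>n. (y - x) ^ n *\<^sub>R diffs c n) sums g' y" if y: "\<bar>y - x\<bar> < min r s" for y
  proof -
    have "y \<in> U" using s(2) y by (auto simp: dist_real_def subset_iff abs_minus_commute)
    then show ?thesis
      using power_series_DERIV[OF rc(2), where y=y] y DERIV_unique[OF g'] by (force simp: mult.commute)
  qed
  moreover have "min r s > 0" using rc s by simp
  ultimately show "\<exists>r>0. \<exists>c. \<forall>y. \<bar>y - x\<bar> < r \<longrightarrow> (\<lambda>n. (y - x) ^ n *\<^sub>R c n) sums g' y"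
    by blast
qed

lemma real_analytic_on_deriv:
  fixes g :: "real \<Rightarrow> real"
  assumes "real_analytic_on g U"
  shows "real_analytic_on (deriv g) U"
  using real_analytic_on_derivative real_analytic_on_DERIV assms by blast

lemma real_analytic_on_funpow_deriv:
  fixes g :: "real \<Rightarrow> real"
  assumes "real_analytic_on g U"
  shows "real_analytic_on ((deriv ^^ k) g) U"
  by (induction k) (auto simp: assms real_analytic_on_deriv)

lemma real_analytic_on_inner:
  fixes g :: "real \<Rightarrow> 'a::real_inner"
  assumes "real_analytic_on g U"
  shows "real_analytic_on (\<lambda>x. g x \<bullet> b) U"
  unfolding real_analytic_on_def
proof (intro conjI ballI)
  show "open U" using assms by (simp add: real_analytic_on_def)
  fix x assume "x \<in> U"
  then obtain r c where rc: "r > 0" "\<And>y. \<bar>y - x\<bar> < r \<Longrightarrow> (\<lambda>n. (y - x) ^ n *\<^sub>R c n) sums g y"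
    using assms unfolding real_analytic_on_def by blast
  have "(\<lambda>n. (y - x) ^ n *\<^sub>R (c n \<bullet> b)) sums (g y \<bullet> b)" if "\<bar>y - x\<bar> < r" for y
    using bounded_linear.sums[OF bounded_linear_inner_left rc(2)[OF that]] by simp
  then show "\<exists>r>0. \<exists>c. \<forall>y. \<bar>y - x\<bar> < r \<longrightarrow> (\<lambda>n. (y - x) ^ n *\<^sub>R c n) sums (g y \<bullet> b)"
    using rc(1) by (intro exI[of _ r]) (auto intro!: exI[of _ "\<lambda>n. c n \<bullet> b"])
qed

text \<open>Differentiating the coordinates with respect to \<open>Basis\<close> reduces the claim
  to scalar functions. The sequence \<open>G\<close> consists of two-sided derivatives, which are
  easier to handle than \<open>deriv_within\<close>.\<close>

lemma real_analytic_on_derivatives: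
  fixes g :: "real \<Rightarrow> 'a::euclidean_space"
  assumes "real_analytic_on g U"
  obtains G where "G 0 = g"
    and "\<And>k x. x \<in> U \<Longrightarrow> (G k has_vector_derivative G (Suc k) x) (at x)"
proof
  define G where "G = (\<lambda>k x. \<Sum>b\<in>Basis. (deriv ^^ k) (\<lambda>y. g y \<bullet> b) x *\<^sub>R b)"
  show "G 0 = g" by (simp add: G_def euclidean_representation)
  fix k x assume "x \<in> U"
  have "((deriv ^^ k) (\<lambda>y. g y \<bullet> b) has_vector_derivative (deriv ^^ Suc k) (\<lambda>y. g y \<bullet> b) x) (at x)" for b
    using real_analytic_on_DERIV[OF real_analytic_on_funpow_deriv[OF real_analytic_on_inner[OF assms]] \<open>x \<in> U\<close>]
    by (simp add: has_real_derivative_iff_has_vector_derivative)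
  then show "(G k has_vector_derivative G (Suc k) x) (at x)"
    unfolding G_def
    by (intro has_vector_derivative_sum)
       (auto intro: bounded_linear.has_vector_derivative[OF bounded_linear_scaleR_left])
qed

text \<open>All Taylor coefficients at \<open>x\<close> vanish, so the local expansion is the zero
  series. This provides the openness needed for the identity theorem.\<close>

lemma real_analytic_zero_near:
  fixes f :: "nat \<Rightarrow> real \<Rightarrow> real"
  assumes f0: "real_analytic_on (f 0) U"
    and deriv: "\<And>k x. x \<in> U \<Longrightarrow> (f k has_real_derivative f (Suc k) x) (at x)"
    and x: "x \<in> U" and zero: "\<And>k. f k x = 0"
  shows "\<exists>e>0. \<forall>y k. \<bar>y - x\<bar> < e \<longrightarrow> f k y = 0"
proof -
  obtain r c where "r > 0" and c0: "\<And>y. \<bar>y - x\<bar> < r \<Longrightarrow> (\<lambda>n. c n * (y - x) ^ n) sums f 0 y"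
    using f0 x unfolding real_analytic_on_def by (force simp: mult.commute)
  obtain s where "s > 0" and s: "ball x s \<subseteq> U"
    using f0 x unfolding real_analytic_on_def open_contains_ball by blast
  define e where "e = min r s"
  have "e > 0" using \<open>r > 0\<close> \<open>s > 0\<close> by (simp add: e_def)
  have U: "y \<in> U" if "\<bar>y - x\<bar> < e" for y
    using s that by (auto simp: e_def dist_real_def subset_iff abs_minus_commute)
  \<comment> \<open>Uniqueness of derivatives identifies the \<open>k\<close>-fold differentiated
    series with \<open>f k\<close>, on one ball for all \<open>k\<close>.\<close>
  have series: "(\<lambda>n. (diffs ^^ k) c n * (y - x) ^ n) sums f k y" if "\<bar>y - x\<bar> < e" for k y
    using that
  proof (induction k arbitrary: y)
    case 0
    then show ?case using c0 by (simp add: e_def)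
  next
    case (Suc k)
    from power_series_DERIV[OF Suc.IH Suc.prems] deriv[OF U[OF Suc.prems], of k]
    show ?case by (auto dest: DERIV_unique)
  qed
  \<comment> \<open>At the centre only the constant term of the series survives.\<close>
  have "(diffs ^^ k) c 0 = 0" for k
    using series[of x k] \<open>e > 0\<close> zero[of k] powser_sums_zero_iff[of "(diffs ^^ k) c" "f k x"] by simp
  then have "c = (\<lambda>_. 0)" by (auto simp: funpow_diffs_0)
  moreover have "(diffs ^^ k) (\<lambda>_. 0::real) = (\<lambda>_. 0)" for k
    by (induction k) (auto simp: diffs_def)
  ultimately have "f k y = 0" if "\<bar>y - x\<bar> < e" for k y
    using series[OF that, of k] by (simp add: sums_iff)
  with \<open>e > 0\<close> show ?thesis by blast
qed

text \<open>The set of common zeros of all \<open>f k\<close> is closed in \<open>S\<close> by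
  continuity and open by the local expansion, so connectedness of \<open>S\<close> spreads it from
  \<open>u\<close> to all of \<open>S\<close>.\<close>

lemma real_analytic_identity:
  fixes f :: "nat \<Rightarrow> real \<Rightarrow> real"
  assumes f0: "real_analytic_on (f 0) U"
    and deriv: "\<And>k x. x \<in> U \<Longrightarrow> (f k has_real_derivative f (Suc k) x) (at x)"
    and S: "connected S" "S \<subseteq> U" and u: "u \<in> S" "\<And>k. f k u = 0"
    and y: "y \<in> S"
  shows "f k y = 0"
proof -
  define Z where "Z = {x \<in> S. \<forall>k. f k x = 0}"
  have "closedin (top_of_set S) Z"
  proof -
    have "continuous_on S (f k)" for k
      using deriv S(2) by (intro continuous_at_imp_continuous_on) (auto intro: DERIV_isCont)
    then have "closedin (top_of_set S) (S \<inter> f k -` {0})" for k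
      by (rule continuous_closedin_preimage) simp
    then have "closedin (top_of_set S) (\<Inter>k. S \<inter> f k -` {0})"
      by (intro closedin_INT) auto
    also have "(\<Inter>k. S \<inter> f k -` {0}) = Z" by (auto simp: Z_def)
    finally show ?thesis .
  qed
  moreover have "openin (top_of_set S) Z"
    unfolding openin_euclidean_subtopology_iff
  proof (intro conjI ballI)
    fix x assume "x \<in> Z"
    then obtain e where "e > 0" "\<forall>y k. \<bar>y - x\<bar> < e \<longrightarrow> f k y = 0"
      using real_analytic_zero_near[OF f0 deriv, of x] S(2) by (auto simp: Z_def)
    then show "\<exists>e>0. \<forall>x'\<in>S. dist x' x < e \<longrightarrow> x' \<in> Z"
      by (auto simp: Z_def dist_real_def)
  qed (auto simp: Z_def)
  moreover have "u \<in> Z" using u by (simp add: Z_def)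
  ultimately have "Z = S" using S(1) unfolding connected_clopen by blast
  then show ?thesis using y by (auto simp: Z_def)
qed

text \<open>One-sided derivatives of \<open>F\<close> are derivatives of the extension, restricted
  to the interval. This permits the sequence \<open>G\<close> to replace \<open>deriv_within\<close>
  throughout.\<close>

lemma deriv_within_eq:
  fixes F :: "real \<Rightarrow> 'a::real_normed_vector"
  assumes "a < b" "\<And>x. x \<in> {a..b} \<Longrightarrow> F x = G 0 x"
    and "\<And>k x. x \<in> {a..b} \<Longrightarrow> (G k has_vector_derivative G (Suc k) x) (at x)"
    and "x \<in> {a..b}"
  shows "deriv_within k F {a..b} x = G k x"
  using assms(4)
proof (induction k arbitrary: x)
  case (Suc k)
  have "(G k has_vector_derivative G (Suc k) x) (at x within {a..b})"
    using assms(3)[OF Suc.prems] by (rule has_vector_derivative_at_within)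
  then have "(deriv_within k F {a..b} has_vector_derivative G (Suc k) x) (at x within {a..b})"
    by (rule has_vector_derivative_transform[rotated 2]) (use Suc in auto)
  \<comment> \<open>Since \<open>a < b\<close>, each point is a limit point of the interval,
    endpoints included, so the derivative within it is unique.\<close>
  moreover have "at x within {a..b} \<noteq> bot"
    using assms(1) Suc.prems by (simp add: trivial_limit_within islimpt_Icc)
  ultimately show ?case using vector_derivative_within by simp
qed (use assms in simp)

section \<open>Sublevel estimates uniform in the parameters\<close>

text \<open>Thresholds are parametrised as \<open>\<delta> = \<epsilon> ^ N\<close>, which avoids fractional powers. As \<open>c \<le> 1\<close>, a
  bound for \<open>N\<close> persists for larger exponents, so the property passes to finite unions.\<close>

definition uniform_sublevel :: "(nat \<Rightarrow> real \<Rightarrow> 'a::euclidean_space) \<Rightarrow> (real \<times> real \<times> 'a) set \<Rightarrow> bool" where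
  "uniform_sublevel G A \<longleftrightarrow> (\<exists>N c C. 0 < c \<and> c \<le> 1 \<and> 0 \<le> C \<and>
     (\<forall>\<tau> \<xi> \<epsilon>. 0 < \<epsilon> \<and> \<epsilon> < c \<longrightarrow>
       (\<exists>B\<in>lmeasurable. {v. (v, \<tau>, \<xi>) \<in> A \<and> \<bar>\<tau> + G 1 v \<bullet> \<xi>\<bar> \<le> \<epsilon> ^ N} \<subseteq> B \<and> measure lebesgue B \<le> C * \<epsilon>)))"

lemma uniform_sublevel_empty: "uniform_sublevel G {}"
  unfolding uniform_sublevel_def by (rule exI[of _ 0], rule exI[of _ 1], rule exI[of _ 0]) (auto intro!: bexI[of _ "{}"])

text \<open>The estimate asks only for a measurable cover \<open>B\<close>, so arbitrary subsets
  inherit it without a measurability check.\<close>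

lemma uniform_sublevel_mono:
  assumes "uniform_sublevel G B" "A \<subseteq> B"
  shows "uniform_sublevel G A"
proof -
  have "{v. (v, \<tau>, \<xi>) \<in> A \<and> Q v} \<subseteq> {v. (v, \<tau>, \<xi>) \<in> B \<and> Q v}" for \<tau> \<xi> Q
    using assms(2) by auto
  then show ?thesis
    using assms(1) unfolding uniform_sublevel_def by (meson order_trans)
qed

lemma uniform_sublevel_Un:
  assumes "uniform_sublevel G A" "uniform_sublevel G A'"
  shows "uniform_sublevel G (A \<union> A')"
proof -
  obtain N c C where 1: "0 < c" "c \<le> 1" "0 \<le> C"
    and cov: "\<And>\<tau> \<xi> \<epsilon>. 0 < \<epsilon> \<Longrightarrow> \<epsilon> < c \<Longrightarrow>
      \<exists>B\<in>lmeasurable. {v. (v, \<tau>, \<xi>) \<in> A \<and> \<bar>\<tau> + G 1 v \<bullet> \<xi>\<bar> \<le> \<epsilon> ^ N} \<subseteq> B \<and> measure lebesgue B \<le> C * \<epsilon>"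
    using assms(1) unfolding uniform_sublevel_def by blast
  obtain N' c' C' where 2: "0 < c'" "c' \<le> 1" "0 \<le> C'"
    and cov': "\<And>\<tau> \<xi> \<epsilon>. 0 < \<epsilon> \<Longrightarrow> \<epsilon> < c' \<Longrightarrow>
      \<exists>B\<in>lmeasurable. {v. (v, \<tau>, \<xi>) \<in> A' \<and> \<bar>\<tau> + G 1 v \<bullet> \<xi>\<bar> \<le> \<epsilon> ^ N'} \<subseteq> B \<and> measure lebesgue B \<le> C' * \<epsilon>"
    using assms(2) unfolding uniform_sublevel_def by blast
  show ?thesis
    unfolding uniform_sublevel_def
  proof (rule exI[of _ "max N N'"], rule exI[of _ "min c c'"], rule exI[of _ "C + C'"], intro conjI allI impI)
    fix \<tau> \<xi> and \<epsilon> :: real assume \<epsilon>: "0 < \<epsilon> \<and> \<epsilon> < min c c'"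
    obtain B where B: "B \<in> lmeasurable" "{v. (v, \<tau>, \<xi>) \<in> A \<and> \<bar>\<tau> + G 1 v \<bullet> \<xi>\<bar> \<le> \<epsilon> ^ N} \<subseteq> B"
      "measure lebesgue B \<le> C * \<epsilon>"
      using cov[of \<epsilon> \<tau> \<xi>] \<epsilon> by auto
    obtain B' where B': "B' \<in> lmeasurable" "{v. (v, \<tau>, \<xi>) \<in> A' \<and> \<bar>\<tau> + G 1 v \<bullet> \<xi>\<bar> \<le> \<epsilon> ^ N'} \<subseteq> B'"
      "measure lebesgue B' \<le> C' * \<epsilon>"
      using cov'[of \<epsilon> \<tau> \<xi>] \<epsilon> by auto
    have "\<epsilon> ^ max N N' \<le> \<epsilon> ^ N" "\<epsilon> ^ max N N' \<le> \<epsilon> ^ N'"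
      using \<epsilon> 1 2 by (auto intro!: power_decreasing)
    then have "{v. (v, \<tau>, \<xi>) \<in> A \<union> A' \<and> \<bar>\<tau> + G 1 v \<bullet> \<xi>\<bar> \<le> \<epsilon> ^ max N N'} \<subseteq> B \<union> B'"
      using B(2) B'(2) by (auto intro: order_trans)
    moreover have "measure lebesgue (B \<union> B') \<le> (C + C') * \<epsilon>"
      using measure_Un_le[of B lebesgue B'] B B' by (simp add: fmeasurableD algebra_simps)
    ultimately show "\<exists>B\<in>lmeasurable. {v. (v, \<tau>, \<xi>) \<in> A \<union> A' \<and> \<bar>\<tau> + G 1 v \<bullet> \<xi>\<bar> \<le> \<epsilon> ^ max N N'} \<subseteq> B
        \<and> measure lebesgue B \<le> (C + C') * \<epsilon>"
      using B(1) B'(1) by (meson fmeasurable.Un)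
  qed (use 1 2 in auto)
qed

text \<open>Some derivative, possibly of order 0, of the function
  \<open>\<tau>0 + G 1 v \<bullet> \<xi>0\<close> of \<open>v\<close> is nonzero at
  \<open>u\<close>. By continuity it stays away from 0 for nearby points and parameters, and
  \<open>sublevel_cover\<close> has constants independent of those parameters.\<close>

lemma uniform_sublevel_near:
  fixes G :: "nat \<Rightarrow> real \<Rightarrow> 'a::euclidean_space"
  assumes "open U" "u \<in> U"
    and deriv: "\<And>k x. x \<in> U \<Longrightarrow> (G k has_vector_derivative G (Suc k) x) (at x)"
    and ne: "\<tau>0 + G 1 u \<bullet> \<xi>0 \<noteq> 0 \<or> (\<exists>m\<ge>2. G m u \<bullet> \<xi>0 \<noteq> 0)"
  shows "\<exists>T. open T \<and> (u, \<tau>0, \<xi>0) \<in> T \<and> uniform_sublevel G T"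
proof -
  \<comment> \<open>\<open>f \<tau> \<xi> k\<close> is the \<open>k\<close>-th derivative of
    \<open>\<tau> + G 1 v \<bullet> \<xi>\<close> in \<open>v\<close>; the constant
    \<open>\<tau>\<close> contributes at order 0 only.\<close>
  define f where "f = (\<lambda>\<tau> \<xi> k v. (if k = 0 then \<tau> else 0) + G (Suc k) v \<bullet> \<xi>)"
  have f_deriv: "(f \<tau> \<xi> k has_real_derivative f \<tau> \<xi> (Suc k) v) (at v)" if "v \<in> U" for \<tau> \<xi> k v
  proof -
    have "((\<lambda>v. G (Suc k) v \<bullet> \<xi>) has_vector_derivative G (Suc (Suc k)) v \<bullet> \<xi>) (at v)"
      by (rule bounded_linear.has_vector_derivative[OF bounded_linear_inner_left deriv[OF that]])
    then show ?thesis
      unfolding f_def has_real_derivative_iff_has_vector_derivative[symmetric]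
      by (auto intro!: derivative_eq_intros)
  qed
  obtain m where m: "f \<tau>0 \<xi>0 m u \<noteq> 0"
  proof (cases "\<tau>0 + G 1 u \<bullet> \<xi>0 = 0")
    case True
    then obtain m where "m \<ge> 2" "G m u \<bullet> \<xi>0 \<noteq> 0" using ne by blast
    \<comment> \<open>The family starts at \<open>G 1\<close>, so \<open>G m\<close> has order
      \<open>m - 1\<close>; this is positive, which removes \<open>\<tau>\<close>.\<close>
    then show ?thesis using that[of "m - 1"] by (simp add: f_def)
  next
    case False
    then show ?thesis using that[of 0] by (simp add: f_def)
  qed
  \<comment> \<open>Half the value at the base point leaves room for a strict, hence open,
    condition; the cap 1 is required by \<open>uniform_sublevel\<close>.\<close>
  define c where "c = min 1 (\<bar>f \<tau>0 \<xi>0 m u\<bar> / 2)"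
  have c: "0 < c" "c \<le> 1" "c < \<bar>f \<tau>0 \<xi>0 m u\<bar>" using m by (auto simp: c_def)
  define \<Phi> where "\<Phi> = (\<lambda>(v, \<tau>, \<xi>). \<bar>f \<tau> \<xi> m v\<bar>)"
  have "continuous_on U (G (Suc m))"
    by (intro continuous_at_imp_continuous_on ballI has_vector_derivative_continuous) (rule deriv)
  then have "continuous_on (U \<times> UNIV) (\<lambda>p. G (Suc m) (fst p))"
    by (rule continuous_on_compose2) (auto intro: continuous_intros)
  then have "continuous_on (U \<times> UNIV) \<Phi>"
    unfolding \<Phi>_def f_def case_prod_unfold by (cases "m = 0") (auto intro!: continuous_intros)
  then have "open ((U \<times> UNIV) \<inter> \<Phi> -` {c<..})"
    using \<open>open U\<close> by (intro continuous_open_preimage open_Times) auto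
  moreover have "(u, \<tau>0, \<xi>0) \<in> (U \<times> UNIV) \<inter> \<Phi> -` {c<..}"
    using \<open>u \<in> U\<close> c by (simp add: \<Phi>_def)
  ultimately obtain J0 W where JW: "open J0" "u \<in> J0" "open W" "(\<tau>0, \<xi>0) \<in> W"
    "J0 \<times> W \<subseteq> (U \<times> UNIV) \<inter> \<Phi> -` {c<..}"
    by (rule open_prod_elim) blast
  \<comment> \<open>\<open>J0\<close> is merely open, whereas \<open>sublevel_cover\<close> needs an
    interval.\<close>
  obtain r where r: "r > 0" "ball u r \<subseteq> J0" using JW by (meson open_contains_ball)
  let ?J = "ball u r"
  have "uniform_sublevel G (?J \<times> W)"
    unfolding uniform_sublevel_def
  proof (rule exI[of _ "Suc m"], rule exI[of _ c], rule exI[of _ "4 * (2 ^ m - 1)"], intro conjI allI impI)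
    fix \<tau> \<xi> and \<epsilon> :: real assume \<epsilon>: "0 < \<epsilon> \<and> \<epsilon> < c"
    let ?S = "{v. (v, \<tau>, \<xi>) \<in> ?J \<times> W \<and> \<bar>\<tau> + G 1 v \<bullet> \<xi>\<bar> \<le> \<epsilon> ^ Suc m}"
    show "\<exists>B\<in>lmeasurable. ?S \<subseteq> B \<and> measure lebesgue B \<le> 4 * (2 ^ m - 1) * \<epsilon>"
    proof (cases "(\<tau>, \<xi>) \<in> W")
      case True
      have "\<exists>B\<in>lmeasurable. {x \<in> ?J. \<bar>f \<tau> \<xi> 0 x\<bar> < c * \<epsilon> ^ m} \<subseteq> B \<and> measure lebesgue B \<le> 4 * (2 ^ m - 1) * \<epsilon>"
      proof (rule sublevel_cover)
        have in_U: "v \<in> U \<and> c < \<bar>f \<tau> \<xi> m v\<bar>" if "v \<in> ?J" for v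
        proof -
          have "(v, \<tau>, \<xi>) \<in> J0 \<times> W" using that r(2) True by blast
          then have "(v, \<tau>, \<xi>) \<in> (U \<times> UNIV) \<inter> \<Phi> -` {c<..}" using JW(5) by blast
          then show ?thesis by (simp add: \<Phi>_def)
        qed
        show "(f \<tau> \<xi> k has_real_derivative f \<tau> \<xi> (Suc k) x) (at x)" if "x \<in> ?J" for k x
          using f_deriv in_U[OF that] by blast
        show "c \<le> \<bar>f \<tau> \<xi> m x\<bar>" if "x \<in> ?J" for x
          using in_U[OF that] by simp
        show "is_interval ?J" by (rule is_interval_ball_real)
      qed (use \<epsilon> c in auto)
      \<comment> \<open>The extra power in \<open>Suc m\<close> absorbs the factor \<open>c\<close>
        and makes the threshold strict.\<close>
      moreover have "\<epsilon> ^ Suc m < c * \<epsilon> ^ m" using \<epsilon> by simp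
      then have "?S \<subseteq> {x \<in> ?J. \<bar>f \<tau> \<xi> 0 x\<bar> < c * \<epsilon> ^ m}" by (auto simp: f_def)
      ultimately show ?thesis by (meson order_trans)
    qed (use \<epsilon> in \<open>auto intro!: bexI[of _ "{}"]\<close>)
  qed (use c in auto)
  moreover have "open (?J \<times> W)" "(u, \<tau>0, \<xi>0) \<in> ?J \<times> W" using JW r by (auto intro: open_Times)
  ultimately show ?thesis by blast
qed

lemma sphere_pair: "{(\<tau> :: real, \<xi> :: 'a::real_normed_vector). \<tau>\<^sup>2 + (norm \<xi>)\<^sup>2 = 1} = sphere 0 1"
  by (auto simp: norm_prod_def)

text \<open>Putting \<open>\<epsilon> = \<delta> powr (1 / N)\<close> converts the thresholds back.
  Large \<open>\<delta>\<close> are handled by the trivial bound \<open>b - a\<close>.\<close>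

lemma uniform_sublevel_powr:
  fixes G :: "nat \<Rightarrow> real \<Rightarrow> 'a::euclidean_space"
  assumes "uniform_sublevel G ({a..b} \<times> X)" "a \<le> b"
  shows "\<exists>\<alpha>>0. \<exists>C>0. \<forall>\<delta>>0. (SUP (\<tau>, \<xi>) \<in> X.
           emeasure lebesgue {v \<in> {a..b}. \<bar>\<tau> + G 1 v \<bullet> \<xi>\<bar> \<le> \<delta>}) \<le> ennreal (C * \<delta> powr \<alpha>)"
proof -
  obtain N0 c C0 where c: "0 < c" "c \<le> 1" "0 \<le> C0"
    and cov0: "\<And>\<tau> \<xi> \<epsilon>. 0 < \<epsilon> \<Longrightarrow> \<epsilon> < c \<Longrightarrow> \<exists>B\<in>lmeasurable.
      {v. (v, \<tau>, \<xi>) \<in> {a..b} \<times> X \<and> \<bar>\<tau> + G 1 v \<bullet> \<xi>\<bar> \<le> \<epsilon> ^ N0} \<subseteq> B \<and> measure lebesgue B \<le> C0 * \<epsilon>"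
    using assms(1) unfolding uniform_sublevel_def by blast
  \<comment> \<open>\<open>N0\<close> may be 0; the successor makes \<open>1 / real N\<close> a
    positive exponent.\<close>
  define N where "N = Suc N0"
  define \<alpha> where "\<alpha> = 1 / real N"
  \<comment> \<open>\<open>C0\<close> serves for \<open>\<epsilon> < c\<close>, the quotient gives
    \<open>b - a \<le> C * \<epsilon>\<close> for \<open>\<epsilon> \<ge> c\<close>, and the 1
    ensures positivity.\<close>
  define C where "C = C0 + (b - a) / c + 1"
  have "\<alpha> > 0" by (simp add: \<alpha>_def N_def)
  have C: "C > 0" "C0 \<le> C" "(b - a) / c \<le> C" using c assms(2) by (auto simp: C_def intro: add_nonneg_pos)
  have "emeasure lebesgue {v \<in> {a..b}. \<bar>\<tau> + G 1 v \<bullet> \<xi>\<bar> \<le> \<delta>} \<le> ennreal (C * \<delta> powr \<alpha>)"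
    if "\<delta> > 0" "(\<tau>, \<xi>) \<in> X" for \<delta> \<tau> \<xi>
  proof -
    let ?S = "{v \<in> {a..b}. \<bar>\<tau> + G 1 v \<bullet> \<xi>\<bar> \<le> \<delta>}"
    define \<epsilon> where "\<epsilon> = \<delta> powr \<alpha>"
    have "\<epsilon> > 0" using that by (simp add: \<epsilon>_def)
    have "\<alpha> * real N = 1" by (simp add: \<alpha>_def N_def)
    then have \<epsilon>N: "\<epsilon> ^ N = \<delta>"
      using that by (simp add: \<epsilon>_def powr_power mult.commute)
    have "\<exists>B\<in>lmeasurable. ?S \<subseteq> B \<and> measure lebesgue B \<le> C * \<epsilon>"
    proof (cases "\<epsilon> < c")
      case True
      \<comment> \<open>Here \<open>\<delta> = \<epsilon> * \<epsilon> ^ N0\<close> and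
        \<open>\<epsilon> < 1\<close>.\<close>
      have "\<delta> \<le> \<epsilon> ^ N0"
        using \<epsilon>N \<open>\<epsilon> > 0\<close> True c by (auto simp: N_def intro!: mult_left_le_one_le)
      then have "?S \<subseteq> {v. (v, \<tau>, \<xi>) \<in> {a..b} \<times> X \<and> \<bar>\<tau> + G 1 v \<bullet> \<xi>\<bar> \<le> \<epsilon> ^ N0}"
        using that by auto
      moreover have "C0 * \<epsilon> \<le> C * \<epsilon>" using C \<open>\<epsilon> > 0\<close> by simp
      ultimately show ?thesis using cov0[OF \<open>\<epsilon> > 0\<close> True, of \<tau> \<xi>] by (meson order_trans)
    next
      case False
      have "b - a = (b - a) / c * c" using c by simp
      also have "\<dots> \<le> C * \<epsilon>" using C c False assms(2) by (intro mult_mono) auto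
      finally show ?thesis
        using assms(2) by (intro bexI[of _ "{a..b}"]) (auto simp: measure_completion)
    qed
    then obtain B where B: "B \<in> lmeasurable" "?S \<subseteq> B" "measure lebesgue B \<le> C * \<epsilon>" by blast
    have "emeasure lebesgue ?S \<le> emeasure lebesgue B"
      using B by (intro emeasure_mono fmeasurableD)
    also have "\<dots> = ennreal (measure lebesgue B)" using B by (intro emeasure_eq_measure2)
    also have "\<dots> \<le> ennreal (C * \<epsilon>)" using B by (intro ennreal_leI)
    finally show ?thesis by (simp add: \<epsilon>_def)
  qed
  note bound = this
  show ?thesis
  proof (rule exI[of _ \<alpha>], rule conjI[OF \<open>\<alpha> > 0\<close>], rule exI[of _ C], rule conjI[OF \<open>C > 0\<close>],
      intro allI impI SUP_least)
    fix \<delta> :: real and p :: "real \<times> 'a" assume "\<delta> > 0" "p \<in> X"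
    moreover obtain \<tau> \<xi> where "p = (\<tau>, \<xi>)" by (cases p)
    ultimately show "(case p of (\<tau>, \<xi>) \<Rightarrow> emeasure lebesgue {v \<in> {a..b}. \<bar>\<tau> + G 1 v \<bullet> \<xi>\<bar> \<le> \<delta>})
        \<le> ennreal (C * \<delta> powr \<alpha>)"
      using bound by (simp only: prod.case)
  qed
qed

section \<open>Orthogonal vectors and null sets\<close>

text \<open>A basis of the span of the whole sequence involves finitely many indices, so it lies in
  one of the finite families. As none of these has full rank, neither has the sequence, and one
  \<open>\<xi>\<close> works for all \<open>k\<close>.\<close>

lemma orthogonal_if_spans_small:
  fixes w :: "nat \<Rightarrow> 'a::euclidean_space"
  assumes "\<And>m. 1 \<le> m \<Longrightarrow> dim (span (w ` {2..m + 1})) \<noteq> DIM('a)"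
  shows "\<exists>\<xi>. \<xi> \<noteq> 0 \<and> (\<forall>k\<ge>2. w k \<bullet> \<xi> = 0)"
proof -
  obtain B where B: "B \<subseteq> w ` {2..}" "independent B" "w ` {2..} \<subseteq> span B" "card B = dim (w ` {2..})"
    using basis_exists by blast
  have "finite B" using B(2) by (rule independent_imp_finite)
  then obtain K where K: "K \<subseteq> {2..}" "finite K" "B = w ` K"
    using B(1) finite_subset_image by metis
  obtain n where n: "K \<subseteq> {..n}" using K(2) finite_nat_iff_bounded_le by blast
  \<comment> \<open>\<open>n + 1\<close> plays the role of \<open>m\<close>, so that
    \<open>1 \<le> m\<close> holds even for \<open>n = 0\<close>.\<close>
  have "K \<subseteq> {2..n + 1 + 1}" using K(1) n by force
  then have "dim B \<le> dim (span (w ` {2..n + 1 + 1}))"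
    unfolding K(3) dim_span by (intro dim_subset image_mono)
  moreover have "dim (w ` {2..}) = dim B" using B(2,4) dim_eq_card_independent by metis
  ultimately have "dim (w ` {2..}) < DIM('a)"
    using assms[of "n + 1"] dim_subset_UNIV[of "w ` {2..n + 1 + 1}"] by (simp add: dim_span)
  then obtain \<xi> where "\<xi> \<noteq> 0" "\<And>y. y \<in> span (w ` {2..}) \<Longrightarrow> orthogonal \<xi> y"
    using orthogonal_to_subspace_exists by blast
  then show ?thesis
    by (intro exI[of _ \<xi>]) (auto simp: orthogonal_def inner_commute[of "w _"] intro: span_base)
qed

text \<open>The zero set lies in every sublevel set, and \<open>C * \<delta> powr \<alpha>\<close>
  tends to 0 with \<open>\<delta>\<close>. Continuity of \<open>h\<close> makes these sets closed,
  hence measurable.\<close>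

lemma sublevel_measure_imp_null:
  fixes h :: "real \<Rightarrow> 'a::euclidean_space"
  assumes "0 < \<alpha>" "0 < C" "continuous_on {a..b} h"
    and "\<And>\<delta>. 0 < \<delta> \<Longrightarrow>
      emeasure lebesgue {v \<in> {a..b}. \<bar>\<tau> + h v \<bullet> \<xi>\<bar> \<le> \<delta>} \<le> ennreal (C * \<delta> powr \<alpha>)"
  shows "{v \<in> {a..b}. \<tau> + h v \<bullet> \<xi> = 0} \<in> null_sets lebesgue"
proof -
  let ?Z = "\<lambda>\<delta>. {v \<in> {a..b}. \<bar>\<tau> + h v \<bullet> \<xi>\<bar> \<le> \<delta>}"
  have "closed (?Z \<delta>)" for \<delta>
    by (intro continuous_closed_preimage_constant continuous_on_closed_Collect_le)
       (use assms(3) in \<open>auto intro!: continuous_intros\<close>)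
  then have meas: "?Z \<delta> \<in> sets lebesgue" for \<delta> by (simp add: borel_closed)
  have Z0: "{v \<in> {a..b}. \<tau> + h v \<bullet> \<xi> = 0} = ?Z 0" by auto
  have "emeasure lebesgue (?Z 0) \<le> 0"
  proof (rule ennreal_le_epsilon)
    fix e :: real assume "0 < e"
    \<comment> \<open>Solves \<open>C * \<delta> powr \<alpha> = e\<close>.\<close>
    define \<delta> where "\<delta> = (e / C) powr (1 / \<alpha>)"
    have "0 < \<delta>" "C * \<delta> powr \<alpha> = e" using \<open>0 < e\<close> assms(1,2) by (auto simp: \<delta>_def powr_powr)
    have "emeasure lebesgue (?Z 0) \<le> emeasure lebesgue (?Z \<delta>)"
      using \<open>0 < \<delta>\<close> by (intro emeasure_mono meas) auto
    also have "\<dots> \<le> ennreal (C * \<delta> powr \<alpha>)" using \<open>0 < \<delta>\<close> by (rule assms(4))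
    finally show "emeasure lebesgue (?Z 0) \<le> 0 + ennreal e"
      using \<open>C * \<delta> powr \<alpha> = e\<close> by simp
  qed
  then have "emeasure lebesgue (?Z 0) = 0" by (simp only: le_zero_eq)
  then show ?thesis unfolding Z0 using meas[of 0] by (rule null_setsI)
qed

text \<open>\<open>G 1 v \<bullet> \<xi>\<close> has derivative 0, so it is a constant
  \<open>k\<close>. The pair \<open>(- k, \<xi>)\<close> then has the required zeros, and
  \<open>\<xi> \<noteq> 0\<close> allows it to be normalised.\<close>

lemma orthogonal_second_derivative_imp_unit_zero:
  fixes G :: "nat \<Rightarrow> real \<Rightarrow> 'a::euclidean_space"
  assumes "p < q"
    and deriv: "\<And>x. x \<in> {p..q} \<Longrightarrow> (G 1 has_vector_derivative G 2 x) (at x)"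
    and zero: "\<And>x. x \<in> {p..q} \<Longrightarrow> \<xi> \<bullet> G 2 x = 0"
    and "\<xi> \<noteq> 0"
  shows "\<exists>\<tau> \<eta>. \<tau>\<^sup>2 + (norm \<eta>)\<^sup>2 = 1 \<and> (\<forall>v\<in>{p..q}. \<tau> + G 1 v \<bullet> \<eta> = 0)"
proof -
  have "((\<lambda>v. G 1 v \<bullet> \<xi>) has_real_derivative 0) (at x within {p..q})" if "x \<in> {p..q}" for x
    using bounded_linear.has_vector_derivative[OF bounded_linear_inner_left[of \<xi>] deriv[OF that]] zero[OF that]
    by (auto simp: has_real_derivative_iff_has_vector_derivative inner_commute
        intro: has_vector_derivative_at_within)
  then obtain k where k: "\<And>x. x \<in> {p..q} \<Longrightarrow> G 1 x \<bullet> \<xi> = k"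
    using has_field_derivative_zero_constant[of "{p..q}" "\<lambda>v. G 1 v \<bullet> \<xi>"] by auto
  define s where "s = sqrt (k\<^sup>2 + (norm \<xi>)\<^sup>2)"
  have s2: "s\<^sup>2 = k\<^sup>2 + (norm \<xi>)\<^sup>2" and "s > 0"
    using \<open>\<xi> \<noteq> 0\<close> by (auto simp: s_def intro: add_nonneg_pos)
  show ?thesis
  proof (rule exI[of _ "- k / s"], rule exI[of _ "(1 / s) *\<^sub>R \<xi>"], intro conjI ballI)
    show "(- k / s)\<^sup>2 + (norm ((1 / s) *\<^sub>R \<xi>))\<^sup>2 = 1"
      using \<open>s > 0\<close> by (simp add: power_divide power_mult_distrib add_divide_distrib[symmetric] s2[symmetric])
  qed (use k in \<open>auto simp: field_simps\<close>)
qed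

section \<open>The cycle of implications between the four conditions\<close>

theorem proposition3p3:
  fixes M :: real and F :: "real \<Rightarrow> real ^ 'd"
  assumes "M > 0"
    and "analytic_restriction_on F {-M..M}"
  shows
    "let D = (\<lambda>k. deriv_within k F {-M..M});
         a = (\<exists>\<alpha>>0. \<exists>C>0. \<forall>\<delta>>0.
               (SUP (\<tau>, \<xi>) \<in> {(\<tau> :: real, \<xi> :: real ^ 'd). \<tau>\<^sup>2 + (norm \<xi>)\<^sup>2 = 1}.
                  emeasure lebesgue {v \<in> {-M..M}. \<bar>\<tau> + D 1 v \<bullet> \<xi>\<bar> \<le> \<delta>})
               \<le> ennreal (C * \<delta> powr \<alpha>));
         b = (\<forall>u\<in>{-M..M}. \<exists>m\<ge>1::nat. dim (span ((\<lambda>k. D k u) ` {2..m+1})) = CARD('d));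
         c = (\<forall>(\<tau> :: real) (\<xi> :: real ^ 'd). \<tau>\<^sup>2 + (norm \<xi>)\<^sup>2 = 1 \<longrightarrow>
               {v \<in> {-M..M}. \<tau> + D 1 v \<bullet> \<xi> = 0} \<in> null_sets lebesgue);
         d = (\<forall>(I :: real set) (\<xi> :: real ^ 'd).
               is_interval I \<and> I \<subseteq> {-M..M} \<and> interior I \<noteq> {} \<and> (\<forall>u\<in>I. \<xi> \<bullet> D 2 u = 0)
               \<longrightarrow> \<xi> = 0)
     in (a \<longleftrightarrow> b) \<and> (b \<longleftrightarrow> c) \<and> (c \<longleftrightarrow> d)"
  (is "let D = ?D; a = ?a D; b = ?b D; c = ?c D; d = ?d D in _")
proof -
  obtain U g where U: "{-M..M} \<subseteq> U" and g: "real_analytic_on g U"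
    and Fg: "\<And>x. x \<in> {-M..M} \<Longrightarrow> F x = g x"
    using assms(2) unfolding analytic_restriction_on_def by blast
  have "open U" using g by (simp add: real_analytic_on_def)
  obtain G where G0: "G 0 = g"
    and deriv: "\<And>k x. x \<in> U \<Longrightarrow> (G k has_vector_derivative G (Suc k) x) (at x)"
    using real_analytic_on_derivatives[OF g] by blast
  \<comment> \<open>At every point of the interval, endpoints included, the derivatives of
    \<open>F\<close> become those of the analytic extension.\<close>
  have D: "?D k x = G k x" if "x \<in> {-M..M}" for k x
    using that assms(1) U by (intro deriv_within_eq[where G=G] deriv) (auto simp: G0 Fg)
  have inner_deriv: "((\<lambda>x. G k x \<bullet> \<xi>) has_real_derivative G (Suc k) x \<bullet> \<xi>) (at x)" if "x \<in> U" for k x \<xi>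
    unfolding has_real_derivative_iff_has_vector_derivative
    by (rule bounded_linear.has_vector_derivative[OF bounded_linear_inner_left deriv[OF that]])
  have G_analytic: "real_analytic_on (\<lambda>x. G k x \<bullet> \<xi>) U" for k \<xi>
    by (induction k) (auto simp: G0 intro: real_analytic_on_inner g real_analytic_on_derivative inner_deriv)
  have ac: "?c ?D" if a: "?a ?D"
  proof (intro allI impI)
    fix \<tau> :: real and \<xi> :: "real ^ 'd" assume unit: "\<tau>\<^sup>2 + (norm \<xi>)\<^sup>2 = 1"
    obtain \<alpha> C where "\<alpha> > 0" "C > 0" and bound: "\<And>\<delta>. \<delta> > 0 \<Longrightarrow>
        (SUP (\<tau>, \<xi>) \<in> {(\<tau> :: real, \<xi> :: real ^ 'd). \<tau>\<^sup>2 + (norm \<xi>)\<^sup>2 = 1}.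
          emeasure lebesgue {v \<in> {-M..M}. \<bar>\<tau> + ?D 1 v \<bullet> \<xi>\<bar> \<le> \<delta>}) \<le> ennreal (C * \<delta> powr \<alpha>)"
      using a by blast
    have "continuous_on {-M..M} (G 1)"
      using U deriv by (intro continuous_at_imp_continuous_on ballI has_vector_derivative_continuous) blast
    then have "continuous_on {-M..M} (?D 1)"
      by (subst continuous_on_cong[OF refl D])
    then show "{v \<in> {-M..M}. \<tau> + ?D 1 v \<bullet> \<xi> = 0} \<in> null_sets lebesgue"
    proof (rule sublevel_measure_imp_null[OF \<open>\<alpha> > 0\<close> \<open>C > 0\<close>])
      fix \<delta> :: real assume "\<delta> > 0"
      show "emeasure lebesgue {v \<in> {-M..M}. \<bar>\<tau> + ?D 1 v \<bullet> \<xi>\<bar> \<le> \<delta>} \<le> ennreal (C * \<delta> powr \<alpha>)"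
        by (rule order_trans[OF SUP_upper2[where i="(\<tau>, \<xi>)"] bound[OF \<open>\<delta> > 0\<close>]]) (use unit in auto)
    qed
  qed
  have cd: "?d ?D" if c: "?c ?D"
  proof (intro allI impI, elim conjE, rule ccontr)
    fix I :: "real set" and \<xi> :: "real ^ 'd"
    assume I: "I \<subseteq> {-M..M}" "interior I \<noteq> {}" "\<forall>u\<in>I. \<xi> \<bullet> ?D 2 u = 0" and "\<xi> \<noteq> 0"
    obtain x e where "e > 0" "cball x e \<subseteq> I"
      using I(2) by (metis ex_in_conv mem_interior_cball)
    then have e: "{x - e..x + e} \<subseteq> I" by (simp add: cball_eq_atLeastAtMost)
    obtain \<tau> \<eta> where unit: "\<tau>\<^sup>2 + (norm \<eta>)\<^sup>2 = 1"
      and zero: "\<And>v. v \<in> {x - e..x + e} \<Longrightarrow> \<tau> + G 1 v \<bullet> \<eta> = 0"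
    proof -
      have "\<exists>\<tau> \<eta>. \<tau>\<^sup>2 + (norm \<eta>)\<^sup>2 = 1 \<and> (\<forall>v\<in>{x - e..x + e}. \<tau> + G 1 v \<bullet> \<eta> = 0)"
      proof (rule orthogonal_second_derivative_imp_unit_zero[of _ _ G, OF _ _ _ \<open>\<xi> \<noteq> 0\<close>])
        fix y assume "y \<in> {x - e..x + e}"
        then have "y \<in> I" "y \<in> {-M..M}" using e I(1) by blast+
        then show "\<xi> \<bullet> G 2 y = 0" "(G 1 has_vector_derivative G 2 y) (at y)"
          using I(3) D[of y 2] deriv[of y 1] U by (auto simp: numeral_2_eq_2)
      qed (use \<open>e > 0\<close> in auto)
      then show thesis using that by blast
    qed
    \<comment> \<open>An interval of length \<open>2 * e > 0\<close> inside a null set is the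
      contradiction sought.\<close>
    have "{x - e..x + e} \<subseteq> {v \<in> {-M..M}. \<tau> + ?D 1 v \<bullet> \<eta> = 0}"
    proof
      fix v assume v: "v \<in> {x - e..x + e}"
      then have "v \<in> {-M..M}" using e I(1) by blast
      with zero[OF v] show "v \<in> {v \<in> {-M..M}. \<tau> + ?D 1 v \<bullet> \<eta> = 0}"
        by (simp only: D mem_Collect_eq simp_thms)
    qed
    moreover have "{v \<in> {-M..M}. \<tau> + ?D 1 v \<bullet> \<eta> = 0} \<in> null_sets lebesgue"
      using c unit by blast
    ultimately have "{x - e..x + e} \<in> null_sets lebesgue"
      by (rule null_sets_completion_subset)
    then show False using \<open>e > 0\<close> by (auto simp: null_sets_def)
  qed
  have db: "?b ?D" if d: "?d ?D"
  proof (rule ccontr)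
    assume "\<not> ?b ?D"
    then obtain u where u: "u \<in> {-M..M}"
      and small: "\<And>m. 1 \<le> m \<Longrightarrow> dim (span ((\<lambda>k. ?D k u) ` {2..m + 1})) \<noteq> CARD('d)" by blast
    obtain \<xi> where "\<xi> \<noteq> 0" and \<xi>: "\<And>k. k \<ge> 2 \<Longrightarrow> ?D k u \<bullet> \<xi> = 0"
      using orthogonal_if_spans_small[of "\<lambda>k. ?D k u"] small by (auto simp: DIM_cart)
    \<comment> \<open>The identity theorem is applied to the family shifted by 2, whose member of
      order 0 is \<open>G 2 x \<bullet> \<xi>\<close>; the whole interval then serves as
      \<open>I\<close> in (d).\<close>
    have "G (0 + 2) y \<bullet> \<xi> = 0" if "y \<in> {-M..M}" for y
    proof (rule real_analytic_identity[where f="\<lambda>k x. G (k + 2) x \<bullet> \<xi>" and u=u])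
      show "G (k + 2) u \<bullet> \<xi> = 0" for k using \<xi>[of "k + 2"] D[OF u, of "k + 2"] by simp
      show "((\<lambda>x. G (k + 2) x \<bullet> \<xi>) has_real_derivative G (Suc k + 2) x \<bullet> \<xi>) (at x)" if "x \<in> U" for k x
        using inner_deriv[OF that, of "k + 2"] by simp
      show "real_analytic_on (\<lambda>x. G (0 + 2) x \<bullet> \<xi>) U" by (rule G_analytic)
    qed (use U u that in auto)
    then have "\<forall>y\<in>{-M..M}. \<xi> \<bullet> G 2 y = 0"
      by (simp add: inner_commute numeral_2_eq_2)
    then have "\<forall>y\<in>{-M..M}. \<xi> \<bullet> ?D 2 y = 0" by (simp add: D)
    moreover have "interior {-M..M} \<noteq> {}" using \<open>M > 0\<close> by (simp add: interior_atLeastAtMost_real)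
    ultimately have "is_interval {-M..M} \<and> {-M..M} \<subseteq> {-M..M} \<and> interior {-M..M} \<noteq> {} \<and>
        (\<forall>y\<in>{-M..M}. \<xi> \<bullet> ?D 2 y = 0)"
      by (intro conjI is_interval_cc subset_refl)
    then have "\<xi> = 0" by (rule d[THEN spec, THEN spec, THEN mp])
    with \<open>\<xi> \<noteq> 0\<close> show False by simp
  qed
  have ba: "?a ?D" if b: "?b ?D"
  proof -
    have "uniform_sublevel G ({-M..M} \<times> sphere 0 1)"
    proof (rule compact_union_induct[where P="uniform_sublevel G"])
      fix p :: "real \<times> real \<times> (real ^ 'd)" assume "p \<in> {-M..M} \<times> sphere 0 1"
      then obtain u \<eta> where "p = (u, \<eta>)" "u \<in> {-M..M}" "\<eta> \<in> sphere 0 1" by blast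
      moreover from this(3) have "\<eta> \<noteq> 0" by auto
      ultimately obtain \<tau> \<xi> where p: "p = (u, \<tau>, \<xi>)" "u \<in> {-M..M}" "(\<tau>, \<xi>) \<noteq> 0"
        by (cases \<eta>) blast
      \<comment> \<open>Otherwise \<open>\<xi>\<close> is orthogonal to a spanning family, hence to
        itself, so \<open>\<xi> = 0\<close>. The first alternative then leaves
        \<open>\<tau> = 0\<close>, but the pair is nonzero.\<close>
      have "\<tau> + G 1 u \<bullet> \<xi> \<noteq> 0 \<or> (\<exists>m\<ge>2. G m u \<bullet> \<xi> \<noteq> 0)"
      proof (rule ccontr)
        assume neg: "\<not> ?thesis"
        obtain m where "dim (span ((\<lambda>k. ?D k u) ` {2..m + 1})) = CARD('d)"
          using bspec[OF b p(2)] by blast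
        then have "span ((\<lambda>k. ?D k u) ` {2..m + 1}) = UNIV"
          using dim_eq_full[of "(\<lambda>k. ?D k u) ` {2..m + 1}"] by (simp add: dim_span)
        then have "orthogonal \<xi> \<xi>"
          using neg D[OF p(2)]
          by (intro orthogonal_to_span[of \<xi> "(\<lambda>k. ?D k u) ` {2..m + 1}"])
             (auto simp: orthogonal_def inner_commute)
        then have "\<xi> = 0" by (simp add: orthogonal_self)
        with neg p(3) show False by (simp add: zero_prod_def)
      qed
      then show "\<exists>T. open T \<and> p \<in> T \<and> uniform_sublevel G T"
        unfolding p(1) by (intro uniform_sublevel_near[where U=U] deriv \<open>open U\<close> subsetD[OF U p(2)])
    next
      show "compact ({-M..M} \<times> sphere 0 1 :: (real \<times> real \<times> (real ^ 'd)) set)"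
        by (intro compact_Times) auto
    qed (auto intro: uniform_sublevel_empty uniform_sublevel_Un uniform_sublevel_mono)
    then have G_bound: "\<exists>\<alpha>>0. \<exists>C>0. \<forall>\<delta>>0. (SUP (\<tau>, \<xi>) \<in> {(\<tau> :: real, \<xi> :: real ^ 'd). \<tau>\<^sup>2 + (norm \<xi>)\<^sup>2 = 1}.
        emeasure lebesgue {v \<in> {-M..M}. \<bar>\<tau> + G 1 v \<bullet> \<xi>\<bar> \<le> \<delta>}) \<le> ennreal (C * \<delta> powr \<alpha>)"
      unfolding sphere_pair by (rule uniform_sublevel_powr) (use \<open>M > 0\<close> in simp)
    have "{v \<in> {-M..M}. \<bar>\<tau> + ?D 1 v \<bullet> \<xi>\<bar> \<le> \<delta>} = {v \<in> {-M..M}. \<bar>\<tau> + G 1 v \<bullet> \<xi>\<bar> \<le> \<delta>}" for \<tau> \<xi> \<delta>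
      by (intro Collect_cong conj_cong refl) (simp only: D)
    with G_bound show ?thesis by (simp only:)
  qed
  have cycle: "(A \<longleftrightarrow> B) \<and> (B \<longleftrightarrow> C) \<and> (C \<longleftrightarrow> D)"
    if "A \<Longrightarrow> C" "C \<Longrightarrow> D" "D \<Longrightarrow> B" "B \<Longrightarrow> A" for A B C D
    using that by blast
  show ?thesis unfolding Let_def by (rule cycle[OF ac cd db ba])
qed

end
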